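(* Suppose $F$ is $C^2$, $\lambda_\ast$ is a local minimum of $F$, and $\hat\lambda_n$ is a local minimum of $\widehat F_n$. Let $\mathcal{D}$ be an open convex neighborhood of $\lambda_\ast$ in the parameter space $\Lambda$ and let $c_0$ be a positive constant. Denote by $\mathcal{A}_n$ the event $$\mathcal{A}_n=\{\hat\lambda_n\in\mathcal{D},\ \nabla_\lambda^2\widehat F_n(\lambda)\succeq c_0 I\ \text{ for all }\lambda\in\mathcal{D}\}.$$ When $\mathcal{A}_n$ takes place, the following holds: $$\|\hat\lambda_n-\lambda_\ast\|\le\frac{\|\partial_\lambda\widehat F_n(\lambda_\ast)-\partial_\lambda F(\lambda_\ast)\|}{c_0}.$$ In particular, $$\mathbb{E}\big[1_{\mathcal{A}_n}\|\hat\lambda_n-\lambda_\ast\|\big]\le\frac{\sqrt{\mathrm{tr}(\mathrm{Var}(\partial_\lambda f(\lambda_\ast,Z)))}}{c_0\sqrt n}.$$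
   Context: Let $(U,Y)$ be a random variable with values in $\mathbb{R}^d\times\mathbb{R}^K$ and $Z=(U,Y)$. The regularization parameter $\lambda$ ranges over $\Lambda\subset\mathbb{R}^p$; "open" means open in $\mathbb{R}^p$. For each $\lambda\in\Lambda$ and $y\in\mathbb{R}^K$, $u_\lambda(y)\in\mathbb{R}^d$ denotes the minimizer over $u\in\mathbb{R}^d$ of the regularized loss $\mathcal{L}_{\mathcal{Y}}(\mathcal{G}(u),y)+\mathcal{S}_\lambda(u)$, where $\mathcal{G}:\mathbb{R}^d\to\mathbb{R}^K$ is the forward map, $\mathcal{L}_{\mathcal{Y}}:\mathbb{R}^K\times\mathbb{R}^K\to[0,\infty)$ a discrepancy function and $\mathcal{S}_\lambda:\mathbb{R}^d\to[0,\infty)$ a regularization function. With a discrepancy function $\mathcal{L}_{\mathcal{U}}:\mathbb{R}^d\times\mathbb{R}^d\to[0,\infty)$, put, for $z=(u,y)$, $$f(\lambda,z)=\mathcal{L}_{\mathcal{U}}(u_\lambda(y),u),\qquad F(\lambda)=\mathbb{E}[f(\lambda,Z)],\qquad \widehat F_n(\lambda)=\frac1n\sum_{j=1}^n f(\lambda,z_j),$$ where $z_1,\dots,z_n$ are i.i.d. copies of $Z$. Standing assumptions: $f$ and its first and second order derivatives in $\lambda$ are continuous in $\lambda$ and integrable, and differentiation and expectation may be interchanged, $\partial_\lambda F(\lambda)=\mathbb{E}[\partial_\lambda f(\lambda,Z)]$. $\mathrm{Var}$ denotes the covariance matrix, and $M\succeq c_0I$ means $M-c_0I$ is positive semidefinite.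 *)

theory Defs
  imports "HOL-Probability.Probability"
begin

definition grad :: "(real^'p \<Rightarrow> real) \<Rightarrow> real^'p \<Rightarrow> real^'p" where
  "grad g x = (\<chi> i. frechet_derivative g (at x) (axis i 1))"

definition hessian :: "(real^'p \<Rightarrow> real) \<Rightarrow> real^'p \<Rightarrow> real^'p^'p" where
  "hessian g x = jacobian (grad g) (at x)"

text \<open>Only meant for open \<open>S\<close>. Differentiability is demanded explicitly because
  \<^const>\<open>frechet_derivative\<close> is unspecified at points of non-differentiability.\<close>

definition C2_on :: "(real^'p) set \<Rightarrow> (real^'p \<Rightarrow> real) \<Rightarrow> bool" where
  "C2_on S g \<longleftrightarrow>
     (\<forall>x\<in>S. g differentiable (at x)) \<and>
     (\<forall>x\<in>S. grad g differentiable (at x)) \<and>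
     continuous_on S (hessian g)"

definition local_min_on :: "'a::metric_space set \<Rightarrow> ('a \<Rightarrow> real) \<Rightarrow> 'a \<Rightarrow> bool" where
  "local_min_on S g x \<longleftrightarrow> x \<in> S \<and> (\<exists>e>0. \<forall>y\<in>S. dist y x < e \<longrightarrow> g x \<le> g y)"

definition psd :: "real^'p^'p \<Rightarrow> bool" where
  "psd A \<longleftrightarrow> transpose A = A \<and> (\<forall>v. 0 \<le> v \<bullet> (A *v v))"

definition loewner_ge :: "real^'p^'p \<Rightarrow> real^'p^'p \<Rightarrow> bool" (infix \<open>\<succeq>\<close> 50) where
  "A \<succeq> B \<longleftrightarrow> psd (A - B)"

definition covariance_matrix :: "'w measure \<Rightarrow> ('w \<Rightarrow> real^'p) \<Rightarrow> real^'p^'p" where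
  "covariance_matrix M X =
     (\<chi> i j. \<integral>\<omega>. (X \<omega> $ i - (\<integral>\<omega>'. X \<omega>' $ i \<partial>M)) * (X \<omega> $ j - (\<integral>\<omega>'. X \<omega>' $ j \<partial>M)) \<partial>M)"

definition regularized_loss ::
  "('u \<Rightarrow> 'y) \<Rightarrow> ('y \<Rightarrow> 'y \<Rightarrow> real) \<Rightarrow> ('l \<Rightarrow> 'u \<Rightarrow> real) \<Rightarrow> 'l \<Rightarrow> 'y \<Rightarrow> 'u \<Rightarrow> real" where
  "regularized_loss G LY S l y u = LY (G u) y + S l u"

text \<open>The choice made by \<^const>\<open>arg_min\<close> is harmless only where the minimizer is unique, which
  has to be assumed separately.\<close>

definition regularized_solution ::
  "('u \<Rightarrow> 'y) \<Rightarrow> ('y \<Rightarrow> 'y \<Rightarrow> real) \<Rightarrow> ('l \<Rightarrow> 'u \<Rightarrow> real) \<Rightarrow> 'l \<Rightarrow> 'y \<Rightarrow> 'u" where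
  "regularized_solution G LY S l y = arg_min (regularized_loss G LY S l y) (\<lambda>_. True)"

definition upper_loss ::
  "('u \<Rightarrow> 'y) \<Rightarrow> ('y \<Rightarrow> 'y \<Rightarrow> real) \<Rightarrow> ('l \<Rightarrow> 'u \<Rightarrow> real) \<Rightarrow> ('u \<Rightarrow> 'u \<Rightarrow> real)
     \<Rightarrow> 'l \<Rightarrow> 'u \<times> 'y \<Rightarrow> real" where
  "upper_loss G LY S LU l z = LU (regularized_solution G LY S l (snd z)) (fst z)"

definition risk :: "'w measure \<Rightarrow> ('w \<Rightarrow> 'z) \<Rightarrow> ('l \<Rightarrow> 'z \<Rightarrow> real) \<Rightarrow> 'l \<Rightarrow> real" where
  "risk M Z f l = (\<integral>\<omega>. f l (Z \<omega>) \<partial>M)"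

definition emp_risk :: "nat \<Rightarrow> (nat \<Rightarrow> 'w \<Rightarrow> 'z) \<Rightarrow> ('l \<Rightarrow> 'z \<Rightarrow> real) \<Rightarrow> 'w \<Rightarrow> 'l \<Rightarrow> real" where
  "emp_risk n z f \<omega> l = (1 / real n) * (\<Sum>j=1..n. f l (z j \<omega>))"

definition good_event ::
  "'w measure \<Rightarrow> ('w \<Rightarrow> real^'p \<Rightarrow> real) \<Rightarrow> ('w \<Rightarrow> real^'p) \<Rightarrow> (real^'p) set \<Rightarrow> real \<Rightarrow> 'w set" where
  "good_event M Fn lhat D c0 =
     {\<omega> \<in> space M. lhat \<omega> \<in> D \<and> (\<forall>l\<in>D. hessian (Fn \<omega>) l \<succeq> c0 *\<^sub>R mat 1)}"

end

theory Submission
  imports Defs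
begin

text \<open>On the event, the gradient of the empirical risk is strongly monotone on the convex set \<open>D\<close>
  with constant \<open>c0\<close> (mean value theorem along the segment between the two minimizers) and it
  vanishes at \<open>lhat\<close>, while the gradient of \<open>F\<close> vanishes at \<open>lstar\<close>; Cauchy-Schwarz gives the
  pointwise bound. For the bound in mean, the gradient of the empirical risk at \<open>lstar\<close> is an
  average of i.i.d. vectors with mean \<open>grad F lstar\<close>, whose mean squared deviation is the trace of
  the covariance divided by \<open>n\<close>. The event is measurable because derivatives are limits of
  difference quotients and, the Hessian being continuous, the quantifier over \<open>D\<close> may be restricted
  to a countable dense set.\<close>

section \<open>Gradient and Hessian as representatives of the derivatives\<close>

lemma has_derivative_gradI:
  fixes g :: "real^'p \<Rightarrow> real"
  assumes "g differentiable (at x)"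
  shows "(g has_derivative (\<lambda>h. grad g x \<bullet> h)) (at x)"
proof -
  have g': "(g has_derivative frechet_derivative g (at x)) (at x)"
    using assms frechet_derivative_works by blast
  interpret bounded_linear "frechet_derivative g (at x)"
    using g' by (rule has_derivative_bounded_linear)
  have "frechet_derivative g (at x) h = grad g x \<bullet> h" for h
  proof -
    have "frechet_derivative g (at x) h = frechet_derivative g (at x) (\<Sum>i\<in>UNIV. (h $ i) *\<^sub>R axis i 1)"
      using basis_expansion[of h] by (simp add: scalar_mult_eq_scaleR)
    also have "\<dots> = grad g x \<bullet> h"
      by (simp add: sum scaleR grad_def inner_vec_def mult.commute)
    finally show ?thesis .
  qed
  with g' show ?thesis
    by (metis (no_types, lifting) ext)
qed

lemma has_derivative_imp_grad_eq:
  fixes g :: "real^'p \<Rightarrow> real"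
  assumes "(g has_derivative (\<lambda>h. v \<bullet> h)) (at x)"
  shows "grad g x = v"
  using frechet_derivative_at[OF assms, symmetric]
  by (simp add: grad_def vec_eq_iff inner_axis)

lemma has_derivative_imp_hessian_eq:
  fixes g :: "real^'p \<Rightarrow> real"
  assumes "(grad g has_derivative (\<lambda>h. H *v h)) (at x)"
  shows "hessian g x = H"
  unfolding hessian_def jacobian_def
  by (metis assms frechet_derivative_at matrix_of_matrix_vector_mul)

lemma has_derivative_grad:
  fixes g :: "real^'p \<Rightarrow> real"
  assumes "grad g differentiable (at x)"
  shows "(grad g has_derivative (\<lambda>h. hessian g x *v h)) (at x)"
  using assms unfolding hessian_def jacobian_works .

section \<open>Critical points and strong monotonicity of the gradient\<close>

lemma grad_local_min:
  fixes g :: "real^'p \<Rightarrow> real"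
  assumes "g differentiable (at x)" "local_min_on S g x" "x \<in> interior S"
  shows "grad g x = 0"
proof -
  obtain e where "e > 0" and e: "\<And>y. y \<in> S \<Longrightarrow> dist y x < e \<Longrightarrow> g x \<le> g y"
    using assms(2) unfolding local_min_on_def by blast
  have "\<forall>\<^sub>F y in at x. y \<in> interior S"
    using assms(3) by (simp add: eventually_at_topological) blast
  moreover have "\<forall>\<^sub>F y in at x. dist y x < e"
    using \<open>e > 0\<close> eventually_at by blast
  \<comment> \<open>Interiority makes every point near \<open>x\<close> a competitor inside
    \<open>S\<close>, so a minimum relative to \<open>S\<close> is an unconstrained local one and
    Fermat's rule applies.\<close>
  ultimately have "\<forall>\<^sub>F y in at x. g x \<le> g y"
    by eventually_elim (use e interior_subset in blast)
  then have "(\<lambda>h. grad g x \<bullet> h) = (\<lambda>h. 0)"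
    by (rule has_derivative_local_min[OF has_derivative_gradI[OF assms(1)]])
  then show ?thesis
    by (metis inner_eq_zero_iff)
qed

lemma loewner_ge_scaled_identity_inner:
  assumes "A \<succeq> c *\<^sub>R mat 1"
  shows "c * (norm v)\<^sup>2 \<le> v \<bullet> (A *v v)"
proof -
  have "0 \<le> v \<bullet> ((A - c *\<^sub>R mat 1) *v v)"
    using assms unfolding loewner_ge_def psd_def by blast
  then show ?thesis
    by (simp add: matrix_vector_mult_diff_rdistrib scaleR_matrix_vector_assoc[symmetric]
        inner_diff_right power2_norm_eq_inner)
qed

text \<open>The mean value theorem has no equality form for vector-valued maps, so it is applied to
  the scalar function \<phi>, the gradient along the segment paired with \<open>y - x\<close>. Its
  derivative is the quadratic form of the Hessian at an intermediate point, which convexity keeps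
  inside \<open>D\<close>.\<close>

lemma grad_strongly_monotone:
  fixes g :: "real^'p \<Rightarrow> real"
  assumes "convex D" "x \<in> D" "y \<in> D"
    and diff: "\<And>l. l \<in> D \<Longrightarrow> grad g differentiable (at l)"
    and hess: "\<And>l. l \<in> D \<Longrightarrow> hessian g l \<succeq> c *\<^sub>R mat 1"
  shows "c * (norm (y - x))\<^sup>2 \<le> (grad g y - grad g x) \<bullet> (y - x)"
proof -
  have mem: "x + t *\<^sub>R (y - x) \<in> D" if "0 \<le> t" "t \<le> 1" for t
    using convexD[OF assms(1-3), of "1 - t" t] that by (simp add: algebra_simps)
  define \<phi> where "\<phi> t = grad g (x + t *\<^sub>R (y - x)) \<bullet> (y - x)" for t
  have "(\<phi> has_derivative (\<lambda>s. (hessian g (x + t *\<^sub>R (y - x)) *v (s *\<^sub>R (y - x))) \<bullet> (y - x)))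
      (at t within {0..1})" if "0 \<le> t" "t \<le> 1" for t
  proof -
    have "((\<lambda>t. x + t *\<^sub>R (y - x)) has_derivative (\<lambda>s. s *\<^sub>R (y - x))) (at t within {0..1})"
      by (auto intro!: derivative_eq_intros)
    from has_derivative_compose[OF this has_derivative_grad[OF diff[OF mem[OF that]]]]
    show ?thesis
      unfolding \<phi>_def by (rule has_derivative_inner_left)
  qed
  then obtain t where t: "t \<in> {0<..<1}"
    and "\<phi> 1 - \<phi> 0 = (hessian g (x + t *\<^sub>R (y - x)) *v ((1 - 0) *\<^sub>R (y - x))) \<bullet> (y - x)"
    by (rule bexE[OF mvt_simple[OF zero_less_one]]) auto
  then have "(grad g y - grad g x) \<bullet> (y - x) = (y - x) \<bullet> (hessian g (x + t *\<^sub>R (y - x)) *v (y - x))"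
    by (simp add: \<phi>_def inner_diff_left[of _ _ "y - x"] inner_commute[of "y - x"])
  then show ?thesis
    using loewner_ge_scaled_identity_inner[OF hess[OF mem]] t by simp
qed

text \<open>Strong monotonicity from below and Cauchy-Schwarz from above leave one factor
  \<open>norm (y - x)\<close> to cancel, hence the case split. In the application \<open>g\<close>
  is the empirical risk, \<open>y\<close> its minimizer and \<open>x\<close> the minimizer of the
  true risk, where the gradient of \<open>g\<close> measures the sampling error.\<close>

lemma norm_diff_critical_point_le:
  fixes g :: "real^'p \<Rightarrow> real"
  assumes "convex D" "x \<in> D" "y \<in> D" "c > 0"
    and "\<And>l. l \<in> D \<Longrightarrow> grad g differentiable (at l)"
    and "\<And>l. l \<in> D \<Longrightarrow> hessian g l \<succeq> c *\<^sub>R mat 1"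
    and "grad g y = 0"
  shows "norm (y - x) \<le> norm (grad g x) / c"
proof (cases "y = x")
  case False
  have "c * (norm (y - x))\<^sup>2 \<le> - grad g x \<bullet> (y - x)"
    using grad_strongly_monotone[of D x y g c] assms by simp
  also have "\<dots> \<le> norm (grad g x) * norm (y - x)"
    using norm_cauchy_schwarz[of "- grad g x" "y - x"] by simp
  finally have "c * norm (y - x) \<le> norm (grad g x)"
    using False by (simp add: power2_eq_square mult.assoc[symmetric])
  then show ?thesis
    using \<open>c > 0\<close> by (simp add: field_simps)
qed (use \<open>c > 0\<close> in simp)

section \<open>Calculus of finite averages\<close>

lemma
  fixes g :: "'j \<Rightarrow> real^'p \<Rightarrow> real"
  assumes "\<And>j. j \<in> J \<Longrightarrow> g j differentiable (at x)"
  shows differentiable_scaled_sum: "(\<lambda>l. c * (\<Sum>j\<in>J. g j l)) differentiable (at x)"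
    and grad_scaled_sum: "grad (\<lambda>l. c * (\<Sum>j\<in>J. g j l)) x = c *\<^sub>R (\<Sum>j\<in>J. grad (g j) x)"
proof -
  have "((\<lambda>l. c * (\<Sum>j\<in>J. g j l)) has_derivative (\<lambda>h. c * (\<Sum>j\<in>J. grad (g j) x \<bullet> h))) (at x)"
    by (intro has_derivative_mult_right has_derivative_sum has_derivative_gradI assms)
  \<comment> \<open>Once the derivative is an inner product with a single vector, that vector is the
    gradient; both claims follow from this one fact.\<close>
  then have *: "((\<lambda>l. c * (\<Sum>j\<in>J. g j l)) has_derivative (\<lambda>h. c *\<^sub>R (\<Sum>j\<in>J. grad (g j) x) \<bullet> h)) (at x)"
    by (simp add: inner_sum_left)
  then show "(\<lambda>l. c * (\<Sum>j\<in>J. g j l)) differentiable (at x)"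
    using differentiable_def by blast
  show "grad (\<lambda>l. c * (\<Sum>j\<in>J. g j l)) x = c *\<^sub>R (\<Sum>j\<in>J. grad (g j) x)"
    using * by (rule has_derivative_imp_grad_eq)
qed

text \<open>Taken with \<open>c = 1 / n\<close> and the sample losses as summands, this passes the
  regularity of the loss on to the empirical risk, for every outcome.\<close>

lemma C2_on_scaled_sum:
  fixes g :: "'j \<Rightarrow> real^'p \<Rightarrow> real"
  assumes "open S" and C2: "\<And>j. j \<in> J \<Longrightarrow> C2_on S (g j)"
  shows "C2_on S (\<lambda>l. c * (\<Sum>j\<in>J. g j l))"
proof -
  let ?G = "\<lambda>l. c * (\<Sum>j\<in>J. g j l)"
  have diff: "g j differentiable (at x)" "grad (g j) differentiable (at x)" if "j \<in> J" "x \<in> S" for j x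
    using C2 that unfolding C2_on_def by auto
  have hess: "(grad ?G has_derivative (\<lambda>h. (c *\<^sub>R (\<Sum>j\<in>J. hessian (g j) x)) *v h)) (at x)"
    if "x \<in> S" for x
  proof -
    have "((\<lambda>l. c *\<^sub>R (\<Sum>j\<in>J. grad (g j) l)) has_derivative
        (\<lambda>h. c *\<^sub>R (\<Sum>j\<in>J. hessian (g j) x *v h))) (at x)"
      by (intro has_derivative_scaleR_right has_derivative_sum has_derivative_grad diff that)
    moreover have "(\<Sum>j\<in>J. hessian (g j) x *v h) = (\<Sum>j\<in>J. hessian (g j) x) *v h" for h
      by (induction J rule: infinite_finite_induct) (simp_all add: matrix_vector_mult_add_rdistrib)
    ultimately have "((\<lambda>l. c *\<^sub>R (\<Sum>j\<in>J. grad (g j) l)) has_derivative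
        (\<lambda>h. (c *\<^sub>R (\<Sum>j\<in>J. hessian (g j) x)) *v h)) (at x)"
      by (simp add: scaleR_matrix_vector_assoc)
    \<comment> \<open>The gradient of the sum is known to be the sum of the gradients only on
      \<open>S\<close>; openness of \<open>S\<close> lets the derivative be transferred between the
      two maps.\<close>
    then show ?thesis
      by (rule has_derivative_transform_within_open[OF _ \<open>open S\<close> that])
        (use diff in \<open>simp add: grad_scaled_sum\<close>)
  qed
  have "continuous_on S (\<lambda>x. c *\<^sub>R (\<Sum>j\<in>J. hessian (g j) x))"
    using C2 unfolding C2_on_def by (intro continuous_intros) auto
  then have "continuous_on S (hessian ?G)"
    using has_derivative_imp_hessian_eq[OF hess] by (simp cong: continuous_on_cong)
  then show ?thesis
    unfolding C2_on_def
    by (blast intro: differentiable_scaled_sum diff(1) differentiableI hess)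
qed

section \<open>Measurability of derivatives and of the event\<close>

lemma closed_loewner_ge:
  fixes B :: "real^'p^'p"
  shows "closed {A. A \<succeq> B}"
proof -
  have "continuous_on UNIV (\<lambda>A::real^'p^'p. transpose (A - B))"
    unfolding transpose_def by (intro continuous_intros)
  then have "closed {A. transpose (A - B) = A - B}"
    by (intro closed_Collect_eq continuous_intros)
  \<comment> \<open>For each fixed \<open>v\<close> this is a weak inequality between continuous
    functions of \<open>A\<close>, and intersecting over all \<open>v\<close> preserves closedness.
    Closedness later makes a failure of the Hessian bound an open condition.\<close>
  moreover have "closed {A. 0 \<le> v \<bullet> ((A - B) *v v)}" for v
    by (intro closed_Collect_le continuous_intros)
      (simp add: matrix_vector_mult_def, intro continuous_intros)
  ultimately show ?thesis
    unfolding loewner_ge_def psd_def Collect_conj_eq Collect_all_eq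
    by (intro closed_Int closed_INT) auto
qed

text \<open>The remainder in the definition of the derivative, divided by \<open>s - x\<close>, has
  the same norm as the difference quotient minus \<open>g'\<close>. The limit form is what the
  measurability argument needs.\<close>

lemma has_vector_derivative_imp_quotient_tendsto:
  assumes "(g has_vector_derivative g') (at x)"
  shows "((\<lambda>s. (1 / (s - x)) *\<^sub>R (g s - g x)) \<longlongrightarrow> g') (at x)"
proof -
  have "((\<lambda>s. norm (g s - g x - (s - x) *\<^sub>R g') / norm (s - x)) \<longlongrightarrow> 0) (at x)"
    using assms unfolding has_vector_derivative_def has_derivative_iff_norm by blast
  moreover have "\<forall>\<^sub>F s in at x. norm (g s - g x - (s - x) *\<^sub>R g') / norm (s - x)
      = norm ((1 / (s - x)) *\<^sub>R (g s - g x) - g')"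
    unfolding eventually_at_filter
  proof (intro always_eventually allI impI)
    fix s assume "s \<noteq> x"
    then have "(1 / (s - x)) *\<^sub>R (g s - g x) - g' = (1 / (s - x)) *\<^sub>R (g s - g x - (s - x) *\<^sub>R g')"
      by (simp add: scaleR_diff_right)
    then show "norm (g s - g x - (s - x) *\<^sub>R g') / norm (s - x)
        = norm ((1 / (s - x)) *\<^sub>R (g s - g x) - g')"
      by simp
  qed
  ultimately have "((\<lambda>s. norm ((1 / (s - x)) *\<^sub>R (g s - g x) - g')) \<longlongrightarrow> 0) (at x)"
    by (rule Lim_transform_eventually)
  then show ?thesis
    using tendsto_norm_zero_iff LIM_zero_iff by blast
qed

text \<open>A directional derivative is the pointwise limit of measurable difference quotients along
  one sequence of step sizes that serves all outcomes. The general codomain covers real functions as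
  well as their gradients.\<close>

lemma borel_measurable_frechet_derivative:
  fixes h :: "'a::real_normed_vector \<Rightarrow> 'w \<Rightarrow> 'b::{second_countable_topology, real_normed_vector}"
  assumes "open S" "x \<in> S"
    and meas: "\<And>l. l \<in> S \<Longrightarrow> h l \<in> borel_measurable M"
    and diff: "\<And>\<omega>. \<omega> \<in> space M \<Longrightarrow> (\<lambda>l. h l \<omega>) differentiable (at x)"
  shows "(\<lambda>\<omega>. frechet_derivative (\<lambda>l. h l \<omega>) (at x) v) \<in> borel_measurable M"
proof -
  have "(\<lambda>t. x + t *\<^sub>R v) \<midarrow>0\<rightarrow> x"
    by (rule tendsto_eq_intros refl | simp)+
  then have "\<forall>\<^sub>F t in at (0::real). x + t *\<^sub>R v \<in> S"
    using assms(1,2) topological_tendstoD by fastforce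
  then obtain d where "d > 0" and d: "\<And>t. t \<noteq> 0 \<Longrightarrow> \<bar>t\<bar> < d \<Longrightarrow> x + t *\<^sub>R v \<in> S"
    unfolding eventually_at by (auto simp: dist_real_def)
  \<comment> \<open>The steps are nonzero, tend to 0 and are at most \<open>d / 2\<close>, so every
    point \<open>x + t k *\<^sub>R v\<close> stays in \<open>S\<close>, where \<open>h\<close> is
    known to be measurable.\<close>
  define t where "t k = d / 2 * inverse (real (Suc k))" for k
  have t: "t k \<noteq> 0" "\<bar>t k\<bar> < d" for k
    using \<open>d > 0\<close> unfolding t_def by (auto simp: field_simps abs_mult)
       (smt (verit) mult_nonneg_nonneg of_nat_0_le_iff)
  have "t \<longlonglongrightarrow> 0"
    unfolding t_def using tendsto_mult_right_zero[OF LIMSEQ_inverse_real_of_nat] by blast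
  then have t_lim: "filterlim t (at 0) sequentially"
    using t by (simp add: filterlim_at)
  have lim: "(\<lambda>k. (1 / t k) *\<^sub>R (h (x + t k *\<^sub>R v) \<omega> - h x \<omega>))
      \<longlonglongrightarrow> frechet_derivative (\<lambda>l. h l \<omega>) (at x) v" if "\<omega> \<in> space M" for \<omega>
  proof -
    have g': "((\<lambda>l. h l \<omega>) has_derivative frechet_derivative (\<lambda>l. h l \<omega>) (at x)) (at x)"
      using diff[OF that] frechet_derivative_works by blast
    then have lin: "frechet_derivative (\<lambda>l. h l \<omega>) (at x) (s *\<^sub>R v)
        = s *\<^sub>R frechet_derivative (\<lambda>l. h l \<omega>) (at x) v" for s
      using has_derivative_bounded_linear linear_simps(5) by blast
    have "((\<lambda>s. h (x + s *\<^sub>R v) \<omega>) has_derivative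
        (\<lambda>s. frechet_derivative (\<lambda>l. h l \<omega>) (at x) (s *\<^sub>R v))) (at 0)"
      by (rule has_derivative_compose[where f="\<lambda>s. x + s *\<^sub>R v" and g="\<lambda>l. h l \<omega>"])
        (rule derivative_eq_intros refl | use g' in simp)+
    then have "((\<lambda>s. h (x + s *\<^sub>R v) \<omega>) has_vector_derivative
        frechet_derivative (\<lambda>l. h l \<omega>) (at x) v) (at 0)"
      unfolding has_vector_derivative_def lin .
    then have "((\<lambda>s. (1 / s) *\<^sub>R (h (x + s *\<^sub>R v) \<omega> - h x \<omega>)) \<longlongrightarrow>
        frechet_derivative (\<lambda>l. h l \<omega>) (at x) v) (at 0)"
      by (rule has_vector_derivative_imp_quotient_tendsto[where g="\<lambda>s. h (x + s *\<^sub>R v) \<omega>" and x=0, simplified])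
    then show ?thesis
      using filterlim_compose t_lim by fastforce
  qed
  show ?thesis
    by (rule borel_measurable_LIMSEQ_metric[OF _ lim])
      (use meas d t assms(2) in \<open>auto intro!: borel_measurable_scaleR borel_measurable_diff\<close>)
qed

lemma borel_measurable_vec_lambda:
  fixes f :: "'i::finite \<Rightarrow> 'w \<Rightarrow> real"
  assumes "\<And>i. f i \<in> borel_measurable M"
  shows "(\<lambda>\<omega>. \<chi> i. f i \<omega>) \<in> borel_measurable M"
proof -
  have "(\<lambda>\<omega>. \<Sum>i\<in>UNIV. f i \<omega> *\<^sub>R axis i (1::real)) \<in> borel_measurable M"
    using assms by simp
  moreover have "(\<Sum>i\<in>UNIV. f i \<omega> *\<^sub>R axis i (1::real)) = (\<chi> i. f i \<omega>)" for \<omega>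
    using basis_expansion[of "\<chi> i. f i \<omega>"] by (simp add: scalar_mult_eq_scaleR)
  ultimately show ?thesis
    by simp
qed

lemma borel_measurable_matrix_lambda:
  fixes f :: "'i::finite \<Rightarrow> 'j::finite \<Rightarrow> 'w \<Rightarrow> real"
  assumes "\<And>i j. f i j \<in> borel_measurable M"
  shows "(\<lambda>\<omega>. \<chi> i j. f i j \<omega>) \<in> borel_measurable M"
proof -
  \<comment> \<open>Pairing with the basis matrices reads off single entries, which is the
    coordinate criterion for measurability in a Euclidean space.\<close>
  have "(\<lambda>\<omega>. (\<chi> i j. f i j \<omega>) \<bullet> axis k (axis l 1)) \<in> borel_measurable M" for k l
    using assms by (simp add: inner_axis)
  then show ?thesis
    by (subst borel_measurable_euclidean_space) (auto simp: Basis_vec_def)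
qed

lemma borel_measurable_grad:
  fixes h :: "real^'p \<Rightarrow> 'w \<Rightarrow> real"
  assumes "open S" "x \<in> S"
    and "\<And>l. l \<in> S \<Longrightarrow> h l \<in> borel_measurable M"
    and "\<And>\<omega>. \<omega> \<in> space M \<Longrightarrow> (\<lambda>l. h l \<omega>) differentiable (at x)"
  shows "(\<lambda>\<omega>. grad (\<lambda>l. h l \<omega>) x) \<in> borel_measurable M"
  unfolding grad_def
  by (intro borel_measurable_vec_lambda borel_measurable_frechet_derivative[of S] assms)

text \<open>The limit argument is used twice: first for the gradient at every point of
  \<open>S\<close>, then for the derivative of the gradient at \<open>x\<close>, whose difference
  quotients involve gradients at nearby points.\<close>

lemma borel_measurable_hessian:
  fixes h :: "real^'p \<Rightarrow> 'w \<Rightarrow> real"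
  assumes "open S" "x \<in> S"
    and meas: "\<And>l. l \<in> S \<Longrightarrow> h l \<in> borel_measurable M"
    and C2: "\<And>\<omega>. \<omega> \<in> space M \<Longrightarrow> C2_on S (\<lambda>l. h l \<omega>)"
  shows "(\<lambda>\<omega>. hessian (\<lambda>l. h l \<omega>) x) \<in> borel_measurable M"
proof -
  have "(\<lambda>\<omega>. grad (\<lambda>l. h l \<omega>) y) \<in> borel_measurable M" if "y \<in> S" for y
    using C2 that unfolding C2_on_def by (intro borel_measurable_grad[of S] assms) auto
  then have "(\<lambda>\<omega>. frechet_derivative (grad (\<lambda>l. h l \<omega>)) (at x) v) \<in> borel_measurable M" for v
    using C2 \<open>x \<in> S\<close> unfolding C2_on_def
    by (intro borel_measurable_frechet_derivative[OF \<open>open S\<close>, where h="\<lambda>y \<omega>. grad (\<lambda>l. h l \<omega>) y"]) auto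
  then show ?thesis
    unfolding hessian_def jacobian_def matrix_def
    by (intro borel_measurable_matrix_lambda measurable_compose[OF _ borel_measurable_nth])
qed

lemma sets_good_event:
  fixes Fn :: "'w \<Rightarrow> real^'p \<Rightarrow> real"
  assumes "open D"
    and lhat: "lhat \<in> borel_measurable M"
    and meas: "\<And>l. l \<in> D \<Longrightarrow> (\<lambda>\<omega>. Fn \<omega> l) \<in> borel_measurable M"
    and C2: "\<And>\<omega>. \<omega> \<in> space M \<Longrightarrow> C2_on D (Fn \<omega>)"
  shows "good_event M Fn lhat D c \<in> sets M"
proof -
  let ?C = "{A. A \<succeq> c *\<^sub>R mat 1} :: (real^'p^'p) set"
  obtain Q :: "(real^'p) set" where "countable Q"
    and dense: "\<And>X. open X \<Longrightarrow> X \<noteq> {} \<Longrightarrow> \<exists>d \<in> Q. d \<in> X"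
    using countable_dense_setE by blast
  \<comment> \<open>By continuity of the Hessian and closedness of \<open>?C\<close>, the points of
    \<open>D\<close> violating the bound form an open set; if it is nonempty, it meets the dense set
    \<open>Q\<close>.\<close>
  have dense_suffices: "(\<forall>l\<in>D. hessian (Fn \<omega>) l \<in> ?C) \<longleftrightarrow> (\<forall>l\<in>D \<inter> Q. hessian (Fn \<omega>) l \<in> ?C)"
    if "\<omega> \<in> space M" for \<omega>
  proof -
    have "continuous_on D (hessian (Fn \<omega>))"
      using C2[OF that] unfolding C2_on_def by blast
    then have "open (D \<inter> hessian (Fn \<omega>) -` (- ?C))"
      using \<open>open D\<close> closed_loewner_ge by (auto intro: continuous_open_preimage)
    from dense[OF this] show ?thesis
      by blast
  qed
  have lhat_in_D: "lhat -` D \<inter> space M \<in> sets M"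
    using lhat \<open>open D\<close> by (auto intro: measurable_sets)
  have hess: "{\<omega> \<in> space M. hessian (Fn \<omega>) l \<in> ?C} \<in> sets M" if "l \<in> D" for l
  proof -
    have "(\<lambda>\<omega>. hessian (Fn \<omega>) l) \<in> borel_measurable M"
      using borel_measurable_hessian[of D l "\<lambda>l \<omega>. Fn \<omega> l" M] assms that by simp
    from measurable_sets[OF this borel_closed[OF closed_loewner_ge]] show ?thesis
      by (simp add: vimage_def Int_def conj_commute)
  qed
  have "good_event M Fn lhat D c =
      (lhat -` D \<inter> space M) \<inter> {\<omega> \<in> space M. \<forall>l\<in>D \<inter> Q. hessian (Fn \<omega>) l \<in> ?C}"
    using dense_suffices unfolding good_event_def by auto
  also have "\<dots> \<in> sets M"
    using \<open>countable Q\<close> hess by (intro sets.Int[OF lhat_in_D] sets.sets_Collect_countable_Ball) auto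
  finally show ?thesis .
qed

section \<open>Mean error of an i.i.d. average\<close>

lemma (in prob_space) variance_sum_indep_vars:
  fixes X :: "'i \<Rightarrow> 'a \<Rightarrow> real"
  assumes "finite I" and indep: "indep_vars (\<lambda>_. borel) X I"
    and int: "\<And>i. i \<in> I \<Longrightarrow> integrable M (X i)"
    and int2: "\<And>i. i \<in> I \<Longrightarrow> integrable M (\<lambda>\<omega>. (X i \<omega>)\<^sup>2)"
  shows "integrable M (\<lambda>\<omega>. (\<Sum>i\<in>I. X i \<omega> - expectation (X i))\<^sup>2)"
    and "expectation (\<lambda>\<omega>. (\<Sum>i\<in>I. X i \<omega> - expectation (X i))\<^sup>2) = (\<Sum>i\<in>I. variance (X i))"
proof -
  define Y where "Y i \<omega> = X i \<omega> - expectation (X i)" for i \<omega>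
  have indep_Y: "indep_vars (\<lambda>_. borel) Y I"
    unfolding Y_def by (rule indep_vars_compose2[OF indep]) simp
  have Y: "integrable M (Y i)" "expectation (Y i) = 0" "integrable M (\<lambda>\<omega>. (Y i \<omega>)\<^sup>2)" if "i \<in> I" for i
    using int[OF that] int2[OF that] unfolding Y_def by (simp_all add: power2_diff prob_space)
  \<comment> \<open>Off the diagonal, independence yields both integrability of the product and its
    factorization into two vanishing means; the diagonal terms are the variances.\<close>
  have cross: "integrable M (\<lambda>\<omega>. Y i \<omega> * Y j \<omega>)"
    "expectation (\<lambda>\<omega>. Y i \<omega> * Y j \<omega>) = (if i = j then variance (X i) else 0)"
    if "i \<in> I" "j \<in> I" for i j
  proof -
    have "integrable M (\<lambda>\<omega>. Y i \<omega> * Y j \<omega>) \<and> expectation (\<lambda>\<omega>. Y i \<omega> * Y j \<omega>) = 0" if "i \<noteq> j"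
    proof -
      have "indep_vars (\<lambda>_. borel) Y {i, j}"
        using indep_Y \<open>i \<in> I\<close> \<open>j \<in> I\<close> by (auto intro: indep_vars_subset)
      from indep_vars_integrable[OF _ this] indep_vars_lebesgue_integral[OF _ this]
      show ?thesis
        using Y \<open>i \<in> I\<close> \<open>j \<in> I\<close> \<open>i \<noteq> j\<close> by auto
    qed
    then show "integrable M (\<lambda>\<omega>. Y i \<omega> * Y j \<omega>)"
      "expectation (\<lambda>\<omega>. Y i \<omega> * Y j \<omega>) = (if i = j then variance (X i) else 0)"
      using Y[OF \<open>i \<in> I\<close>] by (cases "i = j"; simp add: power2_eq_square; simp add: Y_def)+
  qed
  have sq: "(\<Sum>i\<in>I. Y i \<omega>)\<^sup>2 = (\<Sum>i\<in>I. \<Sum>j\<in>I. Y i \<omega> * Y j \<omega>)" for \<omega>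
    by (simp add: power2_eq_square sum_product)
  show "integrable M (\<lambda>\<omega>. (\<Sum>i\<in>I. X i \<omega> - expectation (X i))\<^sup>2)"
    unfolding Y_def[symmetric] sq using cross by simp
  show "expectation (\<lambda>\<omega>. (\<Sum>i\<in>I. X i \<omega> - expectation (X i))\<^sup>2) = (\<Sum>i\<in>I. variance (X i))"
    unfolding Y_def[symmetric] sq using cross \<open>finite I\<close> by (simp add: Y_def)
qed

text \<open>Nonnegativity of the variance, which is Jensen's inequality for the square.\<close>

lemma (in prob_space) expectation_le_sqrt_expectation_square:
  fixes X :: "'a \<Rightarrow> real"
  assumes "integrable M X" "integrable M (\<lambda>\<omega>. (X \<omega>)\<^sup>2)"
  shows "expectation X \<le> sqrt (expectation (\<lambda>\<omega>. (X \<omega>)\<^sup>2))"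
  using variance_positive[of X] variance_eq[OF assms] by (intro real_le_rsqrt) simp

lemma integrable_vec_nth:
  fixes X :: "'w \<Rightarrow> real^'p"
  assumes "integrable M X"
  shows "integrable M (\<lambda>\<omega>. X \<omega> $ i)" "(\<integral>\<omega>. X \<omega> $ i \<partial>M) = (\<integral>\<omega>. X \<omega> \<partial>M) $ i"
  using integrable_bounded_linear[OF bounded_linear_vec_nth assms]
    integral_bounded_linear[OF bounded_linear_vec_nth assms] by auto

text \<open>Jensen passes from the norm to its square, which splits into coordinates. In each
  coordinate the variances of independent summands add, so after division by the squared sample size
  a diagonal entry of the covariance over \<open>n\<close> remains.\<close>

lemma (in prob_space) expectation_norm_mean_le:
  fixes X :: "nat \<Rightarrow> 'a \<Rightarrow> real^'p" and W :: "'a \<Rightarrow> real^'p"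
  assumes "n \<ge> 1" and indep: "indep_vars (\<lambda>_. borel) X {1..n}"
    and W: "integrable M W" "integrable M (\<lambda>\<omega>. (norm (W \<omega>))\<^sup>2)"
    and distr: "\<And>j. j \<in> {1..n} \<Longrightarrow> distr M borel (X j) = distr M borel W"
  shows "expectation (\<lambda>\<omega>. norm ((1 / real n) *\<^sub>R (\<Sum>j=1..n. X j \<omega>) - expectation W))
      \<le> sqrt (trace (covariance_matrix M W) / real n)"
proof -
  define m where "m = expectation W"
  have [measurable]: "W \<in> borel_measurable M"
    using W by auto
  have meas_X [measurable]: "X j \<in> borel_measurable M" if "j \<in> {1..n}" for j
    using indep that unfolding indep_vars_def by auto
  \<comment> \<open>Moments depend only on the law, so those of each \<open>X j\<close> can be
    computed from \<open>W\<close> through the common image measure.\<close>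
  have same_int: "integrable M (\<lambda>\<omega>. \<phi> (X j \<omega>)) \<longleftrightarrow> integrable M (\<lambda>\<omega>. \<phi> (W \<omega>))"
    and same_exp: "expectation (\<lambda>\<omega>. \<phi> (X j \<omega>)) = expectation (\<lambda>\<omega>. \<phi> (W \<omega>))"
    if "j \<in> {1..n}" and [measurable]: "\<phi> \<in> borel_measurable borel"
    for j and \<phi> :: "real^'p \<Rightarrow> real"
    using integrable_distr_eq[OF meas_X[OF \<open>j \<in> _\<close>], of \<phi>] integral_distr[OF meas_X[OF \<open>j \<in> _\<close>], of \<phi>]
      integrable_distr_eq[of W M borel \<phi>] integral_distr[of W M borel \<phi>] distr[OF \<open>j \<in> _\<close>]
    by simp_all
  have meas_nth [measurable]: "(\<lambda>\<omega>. W \<omega> $ i) \<in> borel_measurable M" for i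
    by (rule measurable_compose[OF _ borel_measurable_nth]) measurable
  have W2: "integrable M (\<lambda>\<omega>. (W \<omega> $ i)\<^sup>2)" for i
    by (rule Bochner_Integration.integrable_bound[OF W(2)])
      (auto simp: component_le_norm_cart abs_le_square_iff[symmetric])
  have X1: "integrable M (\<lambda>\<omega>. X j \<omega> $ i)" "expectation (\<lambda>\<omega>. X j \<omega> $ i) = m $ i"
    and X2: "integrable M (\<lambda>\<omega>. (X j \<omega> $ i)\<^sup>2)"
    and var: "expectation (\<lambda>\<omega>. (X j \<omega> $ i - m $ i)\<^sup>2) = covariance_matrix M W $ i $ i" if "j \<in> {1..n}" for i j
  proof -
    show "integrable M (\<lambda>\<omega>. X j \<omega> $ i)" "integrable M (\<lambda>\<omega>. (X j \<omega> $ i)\<^sup>2)"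
      using same_int[OF that, of "\<lambda>x. x $ i"] same_int[OF that, of "\<lambda>x. (x $ i)\<^sup>2"]
        integrable_vec_nth(1)[OF W(1)] W2 by auto
    show "expectation (\<lambda>\<omega>. X j \<omega> $ i) = m $ i"
      using same_exp[OF that, of "\<lambda>x. x $ i"] integrable_vec_nth(2)[OF W(1)] unfolding m_def by auto
    show "expectation (\<lambda>\<omega>. (X j \<omega> $ i - m $ i)\<^sup>2) = covariance_matrix M W $ i $ i"
      using same_exp[OF that, of "\<lambda>x. (x $ i - m $ i)\<^sup>2"] integrable_vec_nth(2)[OF W(1)]
      unfolding covariance_matrix_def m_def by (simp add: power2_eq_square)
  qed
  have indep_nth: "indep_vars (\<lambda>_. borel) (\<lambda>j \<omega>. X j \<omega> $ i) {1..n}" for i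
    by (rule indep_vars_compose2[OF indep]) simp
  have sum_sq: "integrable M (\<lambda>\<omega>. (\<Sum>j=1..n. X j \<omega> $ i - m $ i)\<^sup>2)"
    "expectation (\<lambda>\<omega>. (\<Sum>j=1..n. X j \<omega> $ i - m $ i)\<^sup>2) = real n * covariance_matrix M W $ i $ i" for i
    using variance_sum_indep_vars[OF _ indep_nth[of i] X1(1) X2] by (simp_all add: X1(2) var)
  let ?E = "\<lambda>\<omega>. (1 / real n) *\<^sub>R (\<Sum>j=1..n. X j \<omega>) - m"
  have nth: "?E \<omega> $ i = (\<Sum>j=1..n. X j \<omega> $ i - m $ i) / real n" for \<omega> i
    \<comment> \<open>Moving \<open>m\<close> inside the sum rewrites it as an average of
      \<open>n\<close> copies of itself, which requires \<open>n\<close> to be nonzero.\<close>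
    using \<open>n \<ge> 1\<close> by (simp add: sum_subtractf field_simps)
  have norm_sq: "(norm (?E \<omega>))\<^sup>2 = (\<Sum>i\<in>UNIV. (\<Sum>j=1..n. X j \<omega> $ i - m $ i)\<^sup>2 / (real n)\<^sup>2)" for \<omega>
    unfolding power2_norm_eq_inner inner_vec_def nth by (simp add: power2_eq_square)
  have meas_E [measurable]: "?E \<in> borel_measurable M"
    by measurable
  have int_sq: "integrable M (\<lambda>\<omega>. (norm (?E \<omega>))\<^sup>2)"
    unfolding norm_sq using sum_sq(1) by simp
  have "expectation (\<lambda>\<omega>. (norm (?E \<omega>))\<^sup>2) = trace (covariance_matrix M W) / real n"
    unfolding norm_sq trace_def using sum_sq \<open>n \<ge> 1\<close>
    by (simp add: sum_divide_distrib power2_eq_square)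
  moreover have "integrable M (\<lambda>\<omega>. norm (?E \<omega>))"
    by (rule square_integrable_imp_integrable[OF _ int_sq]) measurable
  ultimately show ?thesis
    using expectation_le_sqrt_expectation_square[OF _ int_sq] unfolding m_def by simp
qed

section \<open>Pointwise bound on the event and its consequence in mean\<close>

theorem proposition2p2:
  fixes M :: "'w measure"
    and U :: "'w \<Rightarrow> real^'d" and Y :: "'w \<Rightarrow> real^'k"
    and z :: "nat \<Rightarrow> 'w \<Rightarrow> (real^'d) \<times> (real^'k)"
    and n :: nat
    and \<Lambda> D :: "(real^'p) set"
    and G :: "real^'d \<Rightarrow> real^'k"
    and LY :: "real^'k \<Rightarrow> real^'k \<Rightarrow> real"
    and S :: "real^'p \<Rightarrow> real^'d \<Rightarrow> real"
    and LU :: "real^'d \<Rightarrow> real^'d \<Rightarrow> real"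
    and lstar :: "real^'p" and lhat :: "'w \<Rightarrow> real^'p"
    and c0 :: real
  defines "Z \<equiv> \<lambda>\<omega>. (U \<omega>, Y \<omega>)"
    and "f \<equiv> upper_loss G LY S LU"
  defines "F \<equiv> risk M Z f"
    and "Fn \<equiv> emp_risk n z f"
  defines "A \<equiv> good_event M Fn lhat D c0"
  assumes prob: "prob_space M"
    and U: "U \<in> borel_measurable M" and Y: "Y \<in> borel_measurable M"
    and n: "n \<ge> 1"
    and indep: "prob_space.indep_vars M (\<lambda>_. borel) z {1..n}"
    and copies: "\<And>j. j \<in> {1..n} \<Longrightarrow> distr M borel (z j) = distr M borel Z"
    \<comment> \<open>the two levels of the learning problem\<close>
    and LY_nonneg: "\<And>v y. 0 \<le> LY v y"
    and S_nonneg: "\<And>l u. l \<in> \<Lambda> \<Longrightarrow> 0 \<le> S l u"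
    and LU_nonneg: "\<And>u v. 0 \<le> LU u v"
    and minimizer: "\<And>l y. l \<in> \<Lambda> \<Longrightarrow>
          \<exists>!u. is_arg_min (regularized_loss G LY S l y) (\<lambda>_. True) u"
    \<comment> \<open>standing regularity assumptions; derivatives in l make sense at interior points\<close>
    and f_meas: "\<And>l. l \<in> \<Lambda> \<Longrightarrow> f l \<in> borel_measurable borel"
    and f_cont: "\<And>x. continuous_on \<Lambda> (\<lambda>l. f l x)"
    and f_C2: "\<And>x. C2_on (interior \<Lambda>) (\<lambda>l. f l x)"
    and f_int: "\<And>l. l \<in> \<Lambda> \<Longrightarrow> integrable M (\<lambda>\<omega>. f l (Z \<omega>))"
    and grad_int: "\<And>l. l \<in> interior \<Lambda> \<Longrightarrow> integrable M (\<lambda>\<omega>. grad (\<lambda>l. f l (Z \<omega>)) l)"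
    and hess_int: "\<And>l. l \<in> interior \<Lambda> \<Longrightarrow> integrable M (\<lambda>\<omega>. hessian (\<lambda>l. f l (Z \<omega>)) l)"
    and interchange: "\<And>l. l \<in> interior \<Lambda> \<Longrightarrow>
          grad F l = (\<integral>\<omega>. grad (\<lambda>l. f l (Z \<omega>)) l \<partial>M)"
    \<comment> \<open>hypotheses of the proposition\<close>
    and F_C2: "C2_on (interior \<Lambda>) F"
    and lstar: "local_min_on \<Lambda> F lstar"
    and lhat_meas: "lhat \<in> borel_measurable M"
    and lhat: "\<And>\<omega>. \<omega> \<in> space M \<Longrightarrow> local_min_on \<Lambda> (Fn \<omega>) (lhat \<omega>)"
    and D: "open D" "convex D" "lstar \<in> D" "D \<subseteq> \<Lambda>"
    and c0: "c0 > 0"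
  shows "(\<forall>\<omega>\<in>A. norm (lhat \<omega> - lstar) \<le> norm (grad (Fn \<omega>) lstar - grad F lstar) / c0)
    \<and> A \<in> sets M
    \<and> integrable M (\<lambda>\<omega>. indicator A \<omega> * norm (lhat \<omega> - lstar))
    \<and> (integrable M (\<lambda>\<omega>. (norm (grad (\<lambda>l. f l (Z \<omega>)) lstar))\<^sup>2) \<longrightarrow>
         (\<integral>\<omega>. indicator A \<omega> * norm (lhat \<omega> - lstar) \<partial>M)
           \<le> sqrt (trace (covariance_matrix M (\<lambda>\<omega>. grad (\<lambda>l. f l (Z \<omega>)) lstar)))
              / (c0 * sqrt (real n)))"
proof -
  interpret prob_space M by (rule prob)
  \<comment> \<open>The gradient at \<open>lstar\<close> as a function of the data point alone, to
    be composed with \<open>Z\<close> and with each \<open>z j\<close>.\<close>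
  let ?g = "\<lambda>x. grad (\<lambda>l. f l x) lstar"
  \<comment> \<open>An open subset of \<Lambda> lies in its interior, where the derivative
    hypotheses hold and where minimizers relative to \<Lambda> are critical points.\<close>
  have "D \<subseteq> interior \<Lambda>"
    using D by (simp add: interior_maximal)
  then have lstar_int: "lstar \<in> interior \<Lambda>"
    using D by blast
  have Z [measurable]: "Z \<in> borel_measurable M"
    unfolding Z_def using U Y by measurable
  have z [measurable]: "z j \<in> borel_measurable M" if "j \<in> {1..n}" for j
    using indep that unfolding indep_vars_def by auto
  have Fn_eq: "Fn \<omega> = (\<lambda>l. (1 / real n) * (\<Sum>j=1..n. f l (z j \<omega>)))" for \<omega>
    unfolding Fn_def emp_risk_def by (rule ext) simp
  have Fn_C2: "C2_on (interior \<Lambda>) (Fn \<omega>)" for \<omega>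
    unfolding Fn_eq using f_C2 by (intro C2_on_scaled_sum) auto
  have f_diff: "(\<lambda>l. f l x) differentiable (at l)" if "l \<in> interior \<Lambda>" for x l
    using f_C2 that unfolding C2_on_def by blast
  have grad_Fn: "grad (Fn \<omega>) lstar = (1 / real n) *\<^sub>R (\<Sum>j=1..n. ?g (z j \<omega>))" for \<omega>
    unfolding Fn_eq using f_diff[OF lstar_int] by (rule grad_scaled_sum)
  have Fn_diff: "Fn \<omega> differentiable (at l)" "grad (Fn \<omega>) differentiable (at l)" if "l \<in> D" for \<omega> l
    using Fn_C2 that \<open>D \<subseteq> interior \<Lambda>\<close> unfolding C2_on_def by blast+
  have F_crit: "grad F lstar = 0"
    using F_C2 lstar_int lstar unfolding C2_on_def by (blast intro: grad_local_min)
  have bound: "norm (lhat \<omega> - lstar) \<le> norm (grad (Fn \<omega>) lstar - grad F lstar) / c0" if "\<omega> \<in> A" for \<omega>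
  proof -
    have \<omega>: "\<omega> \<in> space M" "lhat \<omega> \<in> D" "\<And>l. l \<in> D \<Longrightarrow> hessian (Fn \<omega>) l \<succeq> c0 *\<^sub>R mat 1"
      using that unfolding A_def good_event_def by auto
    then have "grad (Fn \<omega>) (lhat \<omega>) = 0"
      using lhat Fn_diff(1) \<open>D \<subseteq> interior \<Lambda>\<close> by (blast intro: grad_local_min)
    then show ?thesis
      using norm_diff_critical_point_le[OF D(2,3) \<omega>(2) c0 Fn_diff(2) \<omega>(3)] F_crit by simp
  qed
  have A: "A \<in> sets M"
    unfolding A_def
  proof (rule sets_good_event[OF D(1) lhat_meas])
    show "C2_on D (Fn \<omega>)" for \<omega>
      using Fn_C2[of \<omega>] \<open>D \<subseteq> interior \<Lambda>\<close> unfolding C2_on_def by (blast intro: continuous_on_subset)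
    fix l assume "l \<in> D"
    then have [measurable]: "f l \<in> borel_measurable borel"
      using D f_meas by blast
    show "(\<lambda>\<omega>. Fn \<omega> l) \<in> borel_measurable M"
      unfolding Fn_eq by measurable
  qed
  \<comment> \<open>Measurability in the data point itself, not merely in the outcome, is what
    carries independence and equality of laws over from \<open>z j\<close> to
    \<open>?g (z j \<omega>)\<close>.\<close>
  have g [measurable]: "?g \<in> borel_measurable borel"
    by (rule borel_measurable_grad[where h=f, OF open_interior lstar_int])
      (use f_meas interior_subset f_diff[OF lstar_int] in blast)+
  have indep_g: "indep_vars (\<lambda>_. borel) (\<lambda>j \<omega>. ?g (z j \<omega>)) {1..n}"
    by (rule indep_vars_compose2[OF indep]) (rule g)
  have distr_g: "distr M borel (\<lambda>\<omega>. ?g (z j \<omega>)) = distr M borel (\<lambda>\<omega>. ?g (Z \<omega>))" if "j \<in> {1..n}" for j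
    using copies[OF that] distr_distr[OF g z[OF that]] distr_distr[OF g Z] by (simp add: comp_def)
  have int_g: "integrable M (\<lambda>\<omega>. ?g (z j \<omega>))" if "j \<in> {1..n}" for j
    using grad_int[OF lstar_int] integrable_distr_eq[OF z[OF that] g] integrable_distr_eq[OF Z g]
      copies[OF that] by simp
  have int_err: "integrable M (\<lambda>\<omega>. norm (grad (Fn \<omega>) lstar - grad F lstar) / c0)"
    unfolding grad_Fn using int_g
    by (intro integrable_divide integrable_norm Bochner_Integration.integrable_diff
        integrable_scaleR_right Bochner_Integration.integrable_sum) auto
  \<comment> \<open>Off the event the left side is 0 and the right side is nonnegative.\<close>
  have pointwise: "indicator A \<omega> * norm (lhat \<omega> - lstar) \<le> norm (grad (Fn \<omega>) lstar - grad F lstar) / c0" for \<omega>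
    using bound[of \<omega>] c0 by (simp add: indicator_def)
  have int_ind: "integrable M (\<lambda>\<omega>. indicator A \<omega> * norm (lhat \<omega> - lstar))"
  proof (rule Bochner_Integration.integrable_bound[OF int_err])
    show "(\<lambda>\<omega>. indicator A \<omega> * norm (lhat \<omega> - lstar)) \<in> borel_measurable M"
      using A lhat_meas by measurable
    show "AE \<omega> in M. norm (indicator A \<omega> * norm (lhat \<omega> - lstar))
        \<le> norm (norm (grad (Fn \<omega>) lstar - grad F lstar) / c0)"
      using pointwise c0 by (intro AE_I2) simp
  qed
  \<comment> \<open>Without the second moment some diagonal entry of the covariance would be the
    integral of a non-integrable function, with default value 0, and the right side would lose its
    meaning.\<close>
  have "(\<integral>\<omega>. indicator A \<omega> * norm (lhat \<omega> - lstar) \<partial>M)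
      \<le> sqrt (trace (covariance_matrix M (\<lambda>\<omega>. ?g (Z \<omega>)))) / (c0 * sqrt (real n))"
    if "integrable M (\<lambda>\<omega>. (norm (?g (Z \<omega>)))\<^sup>2)"
  proof -
    have "expectation (\<lambda>\<omega>. indicator A \<omega> * norm (lhat \<omega> - lstar))
        \<le> expectation (\<lambda>\<omega>. norm (grad (Fn \<omega>) lstar - grad F lstar)) / c0"
      using integral_mono[OF int_ind int_err pointwise] by simp
    \<comment> \<open>Interchanging derivative and expectation identifies
      \<open>grad F lstar\<close> with the mean of \<open>?g (Z \<omega>)\<close>, so the gradient
      error is a centered i.i.d. average.\<close>
    also have "\<dots> \<le> sqrt (trace (covariance_matrix M (\<lambda>\<omega>. ?g (Z \<omega>))) / real n) / c0"
      unfolding grad_Fn interchange[OF lstar_int]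
      using expectation_norm_mean_le[OF n indep_g grad_int[OF lstar_int] that distr_g] c0
      by (intro divide_right_mono) simp_all
    finally show ?thesis
      by (simp add: real_sqrt_divide mult.commute)
  qed
  then show ?thesis
    using bound A int_ind by blast
qed

end
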